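(* Let $X,Y$ be real Banach spaces and let $H$ be a closed subspace of $L(X,Y)$ such that $X^*\otimes Y\subseteq H$. Then $H^*$ has $w^*$-$BDP$ if and only if both $X^{**}$ and $Y^*$ have $w^*$-$BDP$.
   Context: All Banach spaces are real. $B_Z$ and $S_Z$ denote the closed unit ball and unit sphere of a Banach space $Z$, and $Z^*$ its dual. $L(X,Y)$ is the Banach space of bounded linear operators $X\to Y$ with the operator norm. $X^*\otimes Y\subseteq L(X,Y)$ is the linear span of the rank-one operators $x^*\otimes y: x\mapsto x^*(x)y$, $x^*\in X^*$, $y\in Y$. For a Banach space $Z$, a $w^*$-slice of $B_{Z^*}$ is a set $S(B_{Z^*},z,\alpha)=\{f\in B_{Z^*}: f(z)>1-\alpha\}$ with $z\in S_Z$ and $0<\alpha<1$. The dual space $Z^*$ has $w^*$-$BDP$ ($w^*$-Ball Dentable Property) if $B_{Z^*}$ has $w^*$-slices of arbitrarily small diameter. For $H^*$, $X^{**}=(X^* )^*$ and $Y^*$, the preduals used are $H$, $X^*$ and $Y$ respectively. *)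

theory Defs
  imports "HOL-Analysis.Analysis"
begin

text \<open>
  The dual of a linear subspace \<open>Z\<close> of a normed space, equipped with the norm inherited from the
  ambient space. Since \<open>Z\<close> need not be a type, functionals on \<open>Z\<close> are represented by functions on
  the ambient type vanishing off \<open>Z\<close>; this makes the representation unique and closed under
  pointwise linear operations. For \<open>Z = UNIV\<close> one recovers \<^typ>\<open>'a::real_normed_vector \<Rightarrow>\<^sub>L real\<close>;
  see the lemmas below.
\<close>

definition dual_space :: "'a::real_normed_vector set \<Rightarrow> ('a \<Rightarrow> real) set" where
  "dual_space Z = {f. (\<forall>x\<in>Z. \<forall>y\<in>Z. f (x + y) = f x + f y) \<and>
                      (\<forall>c. \<forall>x\<in>Z. f (c *\<^sub>R x) = c * f x) \<and>
                      (\<exists>K. \<forall>x\<in>Z. \<bar>f x\<bar> \<le> K * norm x) \<and>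
                      (\<forall>x. x \<notin> Z \<longrightarrow> f x = 0)}"

definition dual_norm :: "'a::real_normed_vector set \<Rightarrow> ('a \<Rightarrow> real) \<Rightarrow> real" where
  "dual_norm Z f = (SUP x\<in>{x\<in>Z. norm x \<le> 1}. \<bar>f x\<bar>)"

definition dual_ball :: "'a::real_normed_vector set \<Rightarrow> ('a \<Rightarrow> real) set" where
  "dual_ball Z = {f \<in> dual_space Z. dual_norm Z f \<le> 1}"

definition wstar_slice :: "'a::real_normed_vector set \<Rightarrow> 'a \<Rightarrow> real \<Rightarrow> ('a \<Rightarrow> real) set" where
  "wstar_slice Z z \<alpha> = {f \<in> dual_ball Z. f z > 1 - \<alpha>}"

text \<open>The analogue of \<^const>\<open>diameter\<close> for the metric induced by \<^const>\<open>dual_norm\<close>.\<close>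

definition dual_diameter :: "'a::real_normed_vector set \<Rightarrow> ('a \<Rightarrow> real) set \<Rightarrow> real" where
  "dual_diameter Z S =
     (if S = {} then 0 else SUP (f, g)\<in>S \<times> S. dual_norm Z (\<lambda>x. f x - g x))"

text \<open>
  \<open>wstar_BDP Z\<close> says that the dual of \<open>Z\<close>, with predual \<open>Z\<close>, has the \<open>w\<^sup>*\<close>-Ball Dentable Property.
  The slices are nonempty by Hahn-Banach because \<open>norm z = 1\<close>. If \<open>Z = {0}\<close> there are no slices
  and the property fails.
\<close>

definition wstar_BDP :: "'a::real_normed_vector set \<Rightarrow> bool" where
  "wstar_BDP Z \<longleftrightarrow>
     (\<forall>\<epsilon>>0. \<exists>z\<in>Z. \<exists>\<alpha>. norm z = 1 \<and> 0 < \<alpha> \<and> \<alpha> < 1 \<and> dual_diameter Z (wstar_slice Z z \<alpha>) < \<epsilon>)"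

definition rank_one ::
  "('a::real_normed_vector \<Rightarrow>\<^sub>L real) \<Rightarrow> 'b::real_normed_vector \<Rightarrow> ('a \<Rightarrow>\<^sub>L 'b)" where
  "rank_one f y = blinfun_scaleR_left y o\<^sub>L f"

definition finite_rank_tensors ::
  "('a::real_normed_vector \<Rightarrow>\<^sub>L 'b::real_normed_vector) set" where
  "finite_rank_tensors = span {rank_one f y | f y. True}"

lemma rank_one_apply: "blinfun_apply (rank_one f y) x = blinfun_apply f x *\<^sub>R y"
  by (simp add: rank_one_def)

subsection \<open>Agreement with the library's dual when the subspace is the whole space\<close>

lemma dual_space_UNIV: "dual_space UNIV = range (blinfun_apply :: ('a::real_normed_vector \<Rightarrow>\<^sub>L real) \<Rightarrow> _)"
proof (intro subset_antisym subsetI)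
  fix f :: "'a \<Rightarrow> real"
  assume "f \<in> dual_space UNIV"
  then obtain K where add: "\<And>x y. f (x + y) = f x + f y"
    and scale: "\<And>c x. f (c *\<^sub>R x) = c * f x" and K: "\<And>x. \<bar>f x\<bar> \<le> K * norm x"
    by (auto simp: dual_space_def)
  have "bounded_linear f"
    by (rule bounded_linear_intro[where K = K]) (use add scale K in \<open>auto simp: mult.commute\<close>)
  then show "f \<in> range blinfun_apply"
    by (metis bounded_linear_Blinfun_apply rangeI)
next
  fix f :: "'a \<Rightarrow> real"
  assume "f \<in> range blinfun_apply"
  then obtain g where f: "f = blinfun_apply g" by auto
  show "f \<in> dual_space UNIV"
    using norm_blinfun[of g] unfolding f dual_space_def
    by (auto simp: blinfun.add_right blinfun.scaleR_right)
qed

lemma dual_norm_UNIV: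
  fixes f :: "'a::real_normed_vector \<Rightarrow>\<^sub>L real"
  shows "dual_norm UNIV (blinfun_apply f) = norm f"
proof (rule antisym)
  have bound: "\<bar>blinfun_apply f x\<bar> \<le> norm f" if "norm x \<le> 1" for x
    using norm_blinfun[of f x] mult_left_mono[OF that norm_ge_zero[of f]] by simp
  show "dual_norm UNIV (blinfun_apply f) \<le> norm f"
    unfolding dual_norm_def by (rule cSUP_least) (use bound in \<open>auto intro: exI[of _ 0]\<close>)
  have bdd: "bdd_above ((\<lambda>x. \<bar>blinfun_apply f x\<bar>) ` {x \<in> UNIV. norm x \<le> 1})"
    using bound by (auto intro!: bdd_aboveI2)
  have le: "\<bar>blinfun_apply f x\<bar> \<le> dual_norm UNIV (blinfun_apply f)" if "norm x \<le> 1" for x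
    unfolding dual_norm_def by (rule cSUP_upper[OF _ bdd]) (use that in auto)
  show "norm f \<le> dual_norm UNIV (blinfun_apply f)"
  proof (rule norm_blinfun_bound)
    show "0 \<le> dual_norm UNIV (blinfun_apply f)" using le[of 0] by simp
    fix x
    show "norm (blinfun_apply f x) \<le> dual_norm UNIV (blinfun_apply f) * norm x"
    proof (cases "x = 0")
      case False
      then show ?thesis
        using le[of "x /\<^sub>R norm x"] by (simp add: blinfun.scaleR_right abs_mult field_simps)
    qed simp
  qed
qed

lemma wstar_slice_UNIV:
  fixes z :: "'a::real_normed_vector"
  shows "wstar_slice UNIV z \<alpha> =
    blinfun_apply ` {f :: 'a \<Rightarrow>\<^sub>L real. f \<in> cball 0 1 \<and> blinfun_apply f z > 1 - \<alpha>}"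
  by (auto simp: wstar_slice_def dual_ball_def dual_space_UNIV dual_norm_UNIV)

lemma dual_diameter_UNIV:
  fixes S :: "('a::real_normed_vector \<Rightarrow>\<^sub>L real) set"
  shows "dual_diameter UNIV (blinfun_apply ` S) = diameter S"
proof -
  have eq: "dual_norm UNIV (\<lambda>x. blinfun_apply f x - blinfun_apply g x) = dist f g"
    for f g :: "'a \<Rightarrow>\<^sub>L real"
    using dual_norm_UNIV[of "f - g"] by (simp add: dist_norm minus_blinfun.rep_eq)
  have "blinfun_apply ` S \<times> blinfun_apply ` S = map_prod blinfun_apply blinfun_apply ` (S \<times> S)"
    by auto
  then show ?thesis
    by (simp add: dual_diameter_def diameter_def image_image case_prod_unfold eq)
qed

lemma wstar_BDP_UNIV:
  "wstar_BDP (UNIV :: 'a::real_normed_vector set) \<longleftrightarrow>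
     (\<forall>\<epsilon>>0. \<exists>(z::'a) \<alpha>. norm z = 1 \<and> 0 < \<alpha> \<and> \<alpha> < 1 \<and>
        diameter {f :: 'a \<Rightarrow>\<^sub>L real. f \<in> cball 0 1 \<and> blinfun_apply f z > 1 - \<alpha>} < \<epsilon>)"
  by (simp only: wstar_BDP_def wstar_slice_UNIV dual_diameter_UNIV bex_UNIV)

end

theory Submission
  imports Defs
begin

text \<open>
  The property of having small \<open>w\<^sup>*\<close>-slices can be read off the norm of the predual. If \<open>f\<close> and
  \<open>g\<close> norm \<open>z + h\<close> and \<open>z - h\<close>, then \<open>\<parallel>z + h\<parallel> + \<parallel>z - h\<parallel> = f z + g z + (f - g) h\<close>, and for small
  \<open>h\<close> both functionals lie in any prescribed slice at \<open>z\<close>; conversely the same identity, with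
  \<open>\<ge>\<close> in place of \<open>=\<close>, bounds \<open>(f - g) h\<close> for all \<open>f, g\<close> in a thin slice. So small slices exist
  exactly when, for every \<open>\<epsilon>\<close>, the second difference \<open>\<parallel>z + h\<parallel> + \<parallel>z - h\<parallel> - 2\<close> is at most \<open>\<epsilon> t\<close> on
  \<open>\<parallel>h\<parallel> \<le> t\<close> for some unit vector \<open>z\<close> and some \<open>t > 0\<close> (predicate \<open>norm_not_rough\<close>, lemmas
  \<open>wstar_BDP_imp_norm_not_rough\<close> and \<open>norm_not_rough_imp_wstar_BDP\<close>).

  From the operator space to the factors: let \<open>S\<close> be such a point of \<open>H\<close>, let \<open>x\<close> be a unit vector
  with \<open>\<parallel>S x\<parallel>\<close> close to \<open>1\<close>, and let \<open>g\<close> be a functional norming \<open>S x\<close>. Evaluation at \<open>x\<close> and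
  composition with \<open>g\<close> are contractions from \<open>H\<close> to \<open>Y\<close> and to \<open>X\<^sup>*\<close>, they send \<open>S\<close> to vectors of norm
  almost \<open>1\<close>, and rank-one operators lift every vector of \<open>Y\<close> or \<open>X\<^sup>*\<close> without increasing its norm.
  Hence the estimate at \<open>S\<close> passes to \<open>S x\<close> and to \<open>g \<circ> S\<close>
  (\<open>norm_not_rough_range\<close>, \<open>norm_not_rough_dual_domain\<close>).

  From the factors to the operator space: let \<open>f\<close> and \<open>y\<close> determine small slices of the balls of
  \<open>X\<^sup>*\<^sup>*\<close> and \<open>Y\<^sup>*\<close>, and put \<open>z = f \<otimes> y\<close>. If \<open>A\<close> is close to \<open>z\<close> and \<open>g (A x)\<close> almost equals \<open>\<parallel>A\<parallel>\<close>, then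
  \<open>f x * g y\<close> is close to \<open>1\<close>, so up to a common sign \<open>x\<close> and \<open>g\<close> lie in these slices. Pairs \<open>(x, g)\<close>
  for \<open>z + h\<close> and \<open>(x', g')\<close> for \<open>z - h\<close> are therefore close to each other, and
  \<open>g (h x) - g' (h x') = g (h (x - x')) + (g - g') (h x')\<close> is small compared with \<open>t\<close>
  (\<open>norm_not_rough_operators\<close>).
\<close>

section \<open>Norming functionals\<close>

definition sublinear :: "('a::real_vector \<Rightarrow> real) \<Rightarrow> bool" where
  "sublinear q \<longleftrightarrow> (\<forall>x y. q (x + y) \<le> q x + q y) \<and> (\<forall>c\<ge>0. \<forall>x. q (c *\<^sub>R x) \<le> c * q x)"

lemma sublinearD:
  assumes "sublinear q"
  shows "q (x + y) \<le> q x + q y" and "c \<ge> 0 \<Longrightarrow> q (c *\<^sub>R x) = c * q x"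
    and "q 0 = 0" and "- q (- x) \<le> q x"
proof -
  have add: "q (x + y) \<le> q x + q y" for x y
    using assms by (simp add: sublinear_def)
  have le: "q (c *\<^sub>R x) \<le> c * q x" if "c \<ge> 0" for c x
    using assms that by (simp add: sublinear_def)
  show "q (x + y) \<le> q x + q y" by (rule add)
  show zero: "q 0 = 0"
    using add[of 0 0] le[of 0 0] by simp
  show "q (c *\<^sub>R x) = c * q x" if "c \<ge> 0"
  proof (cases "c = 0")
    case False
    with that have "c > 0" by simp
    moreover have "q (inverse c *\<^sub>R c *\<^sub>R x) \<le> inverse c * q (c *\<^sub>R x)"
      by (rule le) (use that in simp)
    ultimately have "c * q x \<le> q (c *\<^sub>R x)" by (simp add: field_simps)
    with le[OF that] show ?thesis by (rule antisym)
  qed (simp add: zero)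
  show "- q (- x) \<le> q x"
    using add[of x "- x"] by (simp add: zero)
qed

text \<open>
  The witness is \<open>r x = inf {q (x + t y) - t q y | t \<ge> 0}\<close>. The reduction serves twice below: if \<open>q\<close> is
  minimal, then \<open>r = q\<close>, so that \<open>q x + q y \<le> q (x + y)\<close>; and at \<open>x = - y\<close> it gives \<open>r (- y) \<le> - q y\<close>, so that everything linear below \<open>r\<close>
  attains \<open>q\<close> at \<open>y\<close>.
\<close>

lemma directional_reduction:
  fixes q :: "'a::real_vector \<Rightarrow> real"
  assumes q: "sublinear q"
  obtains r where "sublinear r" and "r \<le> q" and "\<And>x. r x \<le> q (x + y) - q y"
proof -
  define F where "F x t = q (x + t *\<^sub>R y) - t * q y" for x t
  define r where "r x = (INF t\<in>{0..}. F x t)" for x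
  have lower: "- q (- x) \<le> F x t" if "t \<ge> 0" for x t
    using sublinearD(1)[OF q, of "x + t *\<^sub>R y" "- x"] sublinearD(2)[OF q that, of y]
    by (simp add: F_def)
  have bdd: "bdd_below (F x ` {0..})" for x
    using lower by (intro bdd_belowI2) auto
  have r_le: "r x \<le> F x t" if "t \<ge> 0" for x t
    unfolding r_def by (rule cINF_lower[OF bdd]) (use that in simp)
  have r_ge: "m \<le> r x" if "\<And>t. t \<ge> 0 \<Longrightarrow> m \<le> F x t" for m x
    unfolding r_def by (rule cINF_greatest) (use that in auto)
  have "sublinear r"
    unfolding sublinear_def
  proof (intro conjI allI impI)
    fix x x'
    have "r (x + x') - F x' t \<le> F x s" if "s \<ge> 0" "t \<ge> 0" for s t
      using r_le[of "s + t" "x + x'"] that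
        sublinearD(1)[OF q, of "x + s *\<^sub>R y" "x' + t *\<^sub>R y"]
      by (simp add: F_def algebra_simps)
    then have "r (x + x') - F x' t \<le> r x" if "t \<ge> 0" for t
      using that by (intro r_ge) auto
    then have "r (x + x') - r x \<le> r x'"
      by (intro r_ge) (simp add: algebra_simps)
    then show "r (x + x') \<le> r x + r x'" by simp
  next
    fix c :: real and x
    assume c: "c \<ge> 0"
    have *: "r (c *\<^sub>R x) \<le> c * F x t" if "t \<ge> 0" for t
    proof -
      have "r (c *\<^sub>R x) \<le> F (c *\<^sub>R x) (c * t)"
        by (rule r_le) (use c that in simp)
      also have "\<dots> = c * F x t"
        using sublinearD(2)[OF q c, of "x + t *\<^sub>R y"] by (simp add: F_def algebra_simps)
      finally show ?thesis .
    qed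
    show "r (c *\<^sub>R x) \<le> c * r x"
    proof (cases "c = 0")
      case True
      then show ?thesis using *[of 0] by simp
    next
      case False
      with c have "c > 0" by simp
      then have "r (c *\<^sub>R x) / c \<le> r x"
        using * by (intro r_ge) (simp add: field_simps)
      with \<open>c > 0\<close> show ?thesis by (simp add: field_simps)
    qed
  qed
  moreover have "r x \<le> q x" for x
    using r_le[of 0 x] by (simp add: F_def)
  moreover have "r x \<le> q (x + y) - q y" for x
    using r_le[of 1 x] by (simp add: F_def)
  ultimately show thesis
    using that by (auto simp: le_fun_def)
qed

text \<open>
  Zorn's lemma for the reversed pointwise order. The pointwise infimum of a chain is finite because
  \<open>q x \<ge> - q (- x) \<ge> - p (- x)\<close> for every member \<open>q\<close>, and it is subadditive because of any two members
  the smaller one can be used at both arguments.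
\<close>

lemma minimal_sublinear:
  fixes p :: "'a::real_vector \<Rightarrow> real"
  assumes p: "sublinear p"
  obtains m where "sublinear m" and "m \<le> p" and "\<And>q. sublinear q \<Longrightarrow> q \<le> m \<Longrightarrow> q = m"
proof -
  define A where "A = {q. sublinear q \<and> q \<le> p}"
  have "\<exists>m\<in>A. \<forall>a\<in>A. a \<le> m \<longrightarrow> a = m"
  proof (rule predicate_Zorn)
    show "partial_order_on A (relation_of (\<lambda>a b. b \<le> a) A)"
      by (rule partial_order_on_relation_ofI) auto
  next
    fix C assume C: "C \<in> Chains (relation_of (\<lambda>a b. b \<le> a) A)"
    have CA: "C \<subseteq> A" using C by (rule Chains_relation_of)
    have chain: "q \<le> q' \<or> q' \<le> q" if "q \<in> C" "q' \<in> C" for q q'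
      using C that unfolding Chains_def relation_of_def by auto
    show "\<exists>u\<in>A. \<forall>a\<in>C. u \<le> a"
    proof (cases "C = {}")
      case True
      then show ?thesis using p by (auto simp: A_def)
    next
      case ne: False
      define u where "u x = (INF q\<in>C. q x)" for x
      have lower: "- p (- x) \<le> q x" if "q \<in> C" for q x
      proof -
        have "sublinear q" and "q (- x) \<le> p (- x)"
          using that CA by (auto simp: A_def le_fun_def)
        then show ?thesis using sublinearD(4)[of q x] by linarith
      qed
      have bdd: "bdd_below ((\<lambda>q. q x) ` C)" for x
        using lower by (intro bdd_belowI2) auto
      have u_le: "u x \<le> q x" if "q \<in> C" for q x
        unfolding u_def by (rule cINF_lower[OF bdd that])
      have u_ge: "m \<le> u x" if "\<And>q. q \<in> C \<Longrightarrow> m \<le> q x" for m x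
        unfolding u_def by (rule cINF_greatest[OF ne]) (use that in auto)
      have "sublinear u"
        unfolding sublinear_def
      proof (intro conjI allI impI)
        fix x y
        have "u (x + y) - q' y \<le> q x" if qq: "q \<in> C" "q' \<in> C" for q q'
        proof -
          have sub: "sublinear q" "sublinear q'"
            using qq CA by (auto simp: A_def)
          from chain[OF qq] show ?thesis
          proof
            assume "q \<le> q'"
            then have "q y \<le> q' y" by (simp add: le_fun_def)
            then show ?thesis
              using u_le[OF qq(1), of "x + y"] sublinearD(1)[OF sub(1), of x y] by linarith
          next
            assume "q' \<le> q"
            then have "q' x \<le> q x" by (simp add: le_fun_def)
            then show ?thesis
              using u_le[OF qq(2), of "x + y"] sublinearD(1)[OF sub(2), of x y] by linarith
          qed
        qed
        then have "u (x + y) - q' y \<le> u x" if "q' \<in> C" for q'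
          using that by (intro u_ge) auto
        then have "u (x + y) - u x \<le> u y"
          by (intro u_ge) (simp add: algebra_simps)
        then show "u (x + y) \<le> u x + u y" by simp
      next
        fix c :: real and x
        assume c: "c \<ge> 0"
        have *: "u (c *\<^sub>R x) \<le> c * q x" if "q \<in> C" for q
          using u_le[OF that, of "c *\<^sub>R x"] sublinearD(2)[OF _ c, of q x] that CA
          by (auto simp: A_def)
        show "u (c *\<^sub>R x) \<le> c * u x"
        proof (cases "c = 0")
          case True
          then show ?thesis using * ne by fastforce
        next
          case False
          with c have "c > 0" by simp
          then have "u (c *\<^sub>R x) / c \<le> u x"
            using * by (intro u_ge) (simp add: field_simps)
          with \<open>c > 0\<close> show ?thesis by (simp add: field_simps)
        qed
      qed
      moreover have "u \<le> p"
      proof -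
        from ne obtain q where "q \<in> C" by auto
        then have "u \<le> q" and "q \<le> p" using u_le CA by (auto simp: A_def le_fun_def)
        then show ?thesis by (rule order_trans)
      qed
      ultimately show ?thesis
        using u_le by (auto simp: A_def le_fun_def)
    qed
  qed
  then obtain m where m: "m \<in> A" "\<And>a. a \<in> A \<Longrightarrow> a \<le> m \<Longrightarrow> a = m" by auto
  show thesis
  proof (rule that[of m])
    show "sublinear m" "m \<le> p" using m(1) by (auto simp: A_def)
    then show "q = m" if "sublinear q" "q \<le> m" for q
      using m(2)[of q] that by (auto simp: A_def)
  qed
qed

text \<open>
  Hahn-Banach in the form needed here. Reducing \<open>p\<close> in the direction \<open>z\<close> first fixes the value at \<open>z\<close>;
  a minimal sublinear functional below the reduction cannot be reduced any further, in any direction,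
  and is therefore superadditive as well.
\<close>

lemma linear_below_sublinear:
  fixes p :: "'a::real_vector \<Rightarrow> real"
  assumes p: "sublinear p"
  obtains f where "linear f" and "f \<le> p" and "f z = p z"
proof -
  obtain r where r: "sublinear r" "r \<le> p" "\<And>x. r x \<le> p (x + z) - p z"
    using directional_reduction[OF p] by metis
  obtain f where f: "sublinear f" "f \<le> r" and min: "\<And>q. sublinear q \<Longrightarrow> q \<le> f \<Longrightarrow> q = f"
    using minimal_sublinear[OF r(1)] by metis
  have super: "f x + f y \<le> f (x + y)" for x y
  proof -
    obtain s where s: "sublinear s" "s \<le> f" "\<And>x. s x \<le> f (x + y) - f y"
      using directional_reduction[OF f(1)] by metis
    with min have "s = f" by blast
    with s(3)[of x] show ?thesis by simp
  qed
  have add: "f (x + y) = f x + f y" for x y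
    using super sublinearD(1)[OF f(1)] by (rule antisym[rotated])
  have neg: "f (- x) = - f x" for x
    using add[of x "- x"] sublinearD(3)[OF f(1)] by simp
  have scale: "f (c *\<^sub>R x) = c *\<^sub>R f x" for c x
  proof (cases "c \<ge> 0")
    case False
    then show ?thesis
      using sublinearD(2)[OF f(1), of "- c" x] neg[of "c *\<^sub>R x"] by simp
  qed (simp add: sublinearD(2)[OF f(1)])
  have le: "f \<le> p" using f(2) r(2) by (rule order_trans)
  have "f (- z) \<le> p (- z + z) - p z"
    using f(2) r(3)[of "- z"] by (metis le_fun_def order_trans)
  then have "p z \<le> f z"
    using sublinearD(3)[OF p] by (simp add: neg)
  then have "f z = p z"
    using le by (simp add: le_fun_def antisym)
  moreover have "linear f"
    by (rule linearI) (simp_all add: add scale)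
  ultimately show thesis using le that by blast
qed

lemma norming_functional:
  fixes z :: "'a::real_normed_vector"
  obtains f :: "'a \<Rightarrow>\<^sub>L real" where "norm f \<le> 1" and "f z = norm z"
proof -
  have "sublinear (norm :: 'a \<Rightarrow> real)"
    by (simp add: sublinear_def norm_triangle_ineq)
  then obtain f :: "'a \<Rightarrow> real" where f: "linear f" "f \<le> norm" "f z = norm z"
    by (rule linear_below_sublinear)
  have bound: "norm (f x) \<le> norm x * 1" for x
    using le_funD[OF f(2), of x] le_funD[OF f(2), of "- x"] linear_neg[OF f(1), of x]
    by (simp add: abs_le_iff)
  then have bl: "bounded_linear f"
    using f(1) by (intro bounded_linear_intro[where K = 1]) (auto simp: linear_add linear_scale)
  show thesis
  proof (rule that[of "Blinfun f"])
    show "norm (Blinfun f) \<le> 1"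
      by (rule norm_blinfun_bound) (use bound bl in \<open>auto simp: bounded_linear_Blinfun_apply\<close>)
    show "Blinfun f z = norm z"
      using f(3) bl by (simp add: bounded_linear_Blinfun_apply)
  qed
qed

section \<open>Duals of subspaces\<close>

lemma dual_spaceD:
  assumes "f \<in> dual_space Z" and "x \<in> Z"
  shows "y \<in> Z \<Longrightarrow> f (x + y) = f x + f y" and "f (c *\<^sub>R x) = c * f x"
  using assms by (auto simp: dual_space_def)

lemma dual_norm_upper:
  assumes "f \<in> dual_space Z" and "x \<in> Z" and "norm x \<le> 1"
  shows "\<bar>f x\<bar> \<le> dual_norm Z f"
proof -
  obtain K where K: "\<And>x. x \<in> Z \<Longrightarrow> \<bar>f x\<bar> \<le> K * norm x"
    using assms(1) unfolding dual_space_def by blast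
  have "\<bar>f y\<bar> \<le> \<bar>K\<bar>" if "y \<in> Z" "norm y \<le> 1" for y
  proof -
    have "K * norm y \<le> \<bar>K\<bar> * 1"
      using that by (intro mult_mono) auto
    with K[OF that(1)] show ?thesis by simp
  qed
  then have "bdd_above ((\<lambda>x. \<bar>f x\<bar>) ` {x \<in> Z. norm x \<le> 1})"
    by (intro bdd_aboveI2) auto
  then show ?thesis
    unfolding dual_norm_def by (rule cSUP_upper[rotated]) (use assms in simp)
qed

lemma dual_norm_bound:
  assumes "subspace Z" and "f \<in> dual_space Z" and "x \<in> Z"
  shows "\<bar>f x\<bar> \<le> dual_norm Z f * norm x"
proof (cases "x = 0")
  case True
  have "f (0 *\<^sub>R x) = 0 * f x" using assms by (intro dual_spaceD)
  with True show ?thesis by simp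
next
  case False
  have "f (inverse (norm x) *\<^sub>R x) = inverse (norm x) * f x"
    using assms by (intro dual_spaceD)
  moreover have "\<bar>f (inverse (norm x) *\<^sub>R x)\<bar> \<le> dual_norm Z f"
    using assms False by (intro dual_norm_upper) (auto simp: subspace_scale)
  ultimately have "\<bar>inverse (norm x) * f x\<bar> \<le> dual_norm Z f" by simp
  then show ?thesis using False by (simp add: abs_mult field_simps)
qed

lemma dual_norm_least:
  assumes "0 \<in> Z" and "\<And>x. x \<in> Z \<Longrightarrow> norm x \<le> 1 \<Longrightarrow> \<bar>f x\<bar> \<le> c"
  shows "dual_norm Z f \<le> c"
  unfolding dual_norm_def by (rule cSUP_least) (use assms in \<open>auto intro!: exI[of _ 0]\<close>)

lemma dual_ballD:
  assumes "subspace Z" and "f \<in> dual_ball Z" and "x \<in> Z"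
  shows "f x \<le> norm x"
proof -
  have "\<bar>f x\<bar> \<le> dual_norm Z f * norm x"
    using assms by (intro dual_norm_bound) (auto simp: dual_ball_def)
  also have "\<dots> \<le> 1 * norm x"
    using assms by (intro mult_right_mono) (auto simp: dual_ball_def)
  finally show ?thesis by simp
qed

lemma dual_space_diff:
  assumes "subspace Z" and "f \<in> dual_space Z" and "g \<in> dual_space Z"
  shows "(\<lambda>x. f x - g x) \<in> dual_space Z"
proof -
  have "\<bar>f x - g x\<bar> \<le> (dual_norm Z f + dual_norm Z g) * norm x" if "x \<in> Z" for x
    using dual_norm_bound[OF assms(1,2) that] dual_norm_bound[OF assms(1,3) that]
    by (simp add: algebra_simps)
  then have "\<exists>K. \<forall>x\<in>Z. \<bar>f x - g x\<bar> \<le> K * norm x" by blast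
  then show ?thesis
    using assms by (auto simp: dual_space_def algebra_simps)
qed

lemma dual_norm_le_diameter:
  assumes Z: "subspace Z" and S: "S \<subseteq> dual_ball Z" and fg: "f \<in> S" "g \<in> S"
  shows "dual_norm Z (\<lambda>x. f x - g x) \<le> dual_diameter Z S"
proof -
  have "dual_norm Z (\<lambda>x. f x - g x) \<le> 2" if "f \<in> S" "g \<in> S" for f g
  proof (rule dual_norm_least)
    show "0 \<in> Z" using Z by (rule subspace_0)
    fix x assume x: "x \<in> Z" "norm x \<le> 1"
    have "\<bar>f x\<bar> \<le> 1" "\<bar>g x\<bar> \<le> 1"
      using that S x by (auto simp: dual_ball_def intro: order_trans[OF dual_norm_upper])
    then show "\<bar>f x - g x\<bar> \<le> 2" by linarith
  qed
  then have bdd: "bdd_above ((\<lambda>(f, g). dual_norm Z (\<lambda>x. f x - g x)) ` (S \<times> S))"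
    by (intro bdd_aboveI2[where M = 2]) auto
  show ?thesis
    unfolding dual_diameter_def
    using cSUP_upper[OF _ bdd, of "(f, g)"] fg by auto
qed

text \<open>
  The norm of \<open>Z\<close> is the restriction of the ambient one, so a norming functional of the whole space
  serves after it is cut off outside \<open>Z\<close>.
\<close>

lemma norming_functional_dual_ball:
  assumes "subspace Z" and "z \<in> Z"
  obtains f where "f \<in> dual_ball Z" and "f z = norm z"
proof -
  obtain f where f: "norm f \<le> 1" "blinfun_apply f z = norm z"
    by (rule norming_functional)
  have bound: "\<bar>blinfun_apply f x\<bar> \<le> norm x" for x
    using norm_blinfun[of f x] mult_right_mono[OF f(1) norm_ge_zero[of x]] by simp
  define g where "g x = (if x \<in> Z then blinfun_apply f x else 0)" for x
  have "g \<in> dual_space Z"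
    using assms(1) bound unfolding dual_space_def g_def
    by (auto simp: subspace_add subspace_scale blinfun.add_right blinfun.scaleR_right
        intro!: exI[of _ 1])
  moreover have "dual_norm Z g \<le> 1"
    by (rule dual_norm_least)
      (use assms(1) bound in \<open>auto simp: g_def subspace_0 intro: order_trans\<close>)
  ultimately show thesis
    using that[of g] f(2) assms(2) by (simp add: g_def dual_ball_def)
qed

section \<open>Small slices and rough norms\<close>

text \<open>
  The norm is \<open>\<epsilon>\<close>-rough for no \<open>\<epsilon> > 0\<close>. Here it is \<open>\<epsilon>\<close>-rough if at every unit vector \<open>z\<close> the upper
  limit of \<open>(\<parallel>z + h\<parallel> + \<parallel>z - h\<parallel> - 2) / \<parallel>h\<parallel>\<close> as \<open>h\<close> tends to \<open>0\<close> is at least \<open>\<epsilon>\<close>. The single scale \<open>t\<close>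
  captures the limit, since by convexity of the norm the quotient does not increase when \<open>h\<close> is shrunk along
  a ray. A bound by \<open>\<epsilon> * t\<close> instead of \<open>\<epsilon> * norm h\<close> survives small perturbations of \<open>z\<close>.
\<close>

definition norm_not_rough :: "'a::real_normed_vector set \<Rightarrow> bool" where
  "norm_not_rough Z \<longleftrightarrow>
     (\<forall>\<epsilon>>0. \<exists>z\<in>Z. \<exists>t>0. norm z = 1 \<and>
        (\<forall>h\<in>Z. norm h \<le> t \<longrightarrow> norm (z + h) + norm (z - h) \<le> 2 + \<epsilon> * t))"

lemma wstar_BDP_imp_norm_not_rough:
  assumes Z: "subspace Z" and "wstar_BDP Z"
  shows "norm_not_rough Z"
  unfolding norm_not_rough_def
proof (intro allI impI)
  fix \<epsilon> :: real assume "\<epsilon> > 0"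
  then obtain z \<alpha> where z: "z \<in> Z" "norm z = 1" and \<alpha>: "0 < \<alpha>"
    and diam: "dual_diameter Z (wstar_slice Z z \<alpha>) < \<epsilon>"
    using assms(2) by (auto simp: wstar_BDP_def)
  have slice: "wstar_slice Z z \<alpha> \<subseteq> dual_ball Z" by (auto simp: wstar_slice_def)
  \<comment> \<open>A functional norming \<open>z \<plusminus> h\<close> is at least \<open>1 - 2 \<parallel>h\<parallel>\<close> at \<open>z\<close>, so a third of \<open>\<alpha>\<close> puts it into the slice.\<close>
  have "norm (z + h) + norm (z - h) \<le> 2 + \<epsilon> * (\<alpha> / 3)" if h: "h \<in> Z" "norm h \<le> \<alpha> / 3" for h
  proof -
    have mem: "z + h \<in> Z" "z - h \<in> Z" "- h \<in> Z"
      using Z z(1) h(1) by (auto simp: subspace_add subspace_diff subspace_neg)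
    obtain f where f: "f \<in> dual_ball Z" "f (z + h) = norm (z + h)"
      using norming_functional_dual_ball[OF Z mem(1)] .
    obtain g where g: "g \<in> dual_ball Z" "g (z - h) = norm (z - h)"
      using norming_functional_dual_ball[OF Z mem(2)] .
    have f_add: "f (z + h) = f z + f h" and g_add: "g (z + - h) = g z + g (- h)"
      using f(1) g(1) z(1) h(1) mem by (auto simp: dual_ball_def dual_space_def)
    have "g (- 1 *\<^sub>R h) = - 1 * g h"
      using g(1) h(1) unfolding dual_ball_def dual_space_def by blast
    with g_add have g_diff: "g (z - h) = g z - g h" by simp
    have le: "f z \<le> 1" "g z \<le> 1" "f h \<le> norm h" "g (- h) \<le> norm h"
      using dual_ballD[OF Z f(1) z(1)] dual_ballD[OF Z g(1) z(1)] dual_ballD[OF Z f(1) h(1)]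
        dual_ballD[OF Z g(1) mem(3)] z(2) by auto
    have "norm (z + h) \<ge> 1 - norm h" "norm (z - h) \<ge> 1 - norm h"
      using norm_diff_ineq[of z h] norm_triangle_ineq2[of z h] z(2) by auto
    then have "f \<in> wstar_slice Z z \<alpha>" "g \<in> wstar_slice Z z \<alpha>"
      using f g f_add g_diff g_add le h(2) \<alpha> by (auto simp: wstar_slice_def)
    then have "dual_norm Z (\<lambda>x. f x - g x) \<le> \<epsilon>"
      using dual_norm_le_diameter[OF Z slice] diam by force
    moreover have "\<bar>f h - g h\<bar> \<le> dual_norm Z (\<lambda>x. f x - g x) * norm h"
      using f(1) g(1) h(1) Z
      by (intro dual_norm_bound[where f = "\<lambda>x. f x - g x"] dual_space_diff) (auto simp: dual_ball_def)
    moreover have "dual_norm Z (\<lambda>x. f x - g x) * norm h \<le> \<epsilon> * (\<alpha> / 3)"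
      using calculation(1) h(2) \<open>\<epsilon> > 0\<close> by (intro mult_mono) auto
    ultimately have "f h - g h \<le> \<epsilon> * (\<alpha> / 3)" by linarith
    then show ?thesis
      using le f(2) g(2) f_add g_diff by linarith
  qed
  then show "\<exists>z\<in>Z. \<exists>t>0. norm z = 1 \<and>
        (\<forall>h\<in>Z. norm h \<le> t \<longrightarrow> norm (z + h) + norm (z - h) \<le> 2 + \<epsilon> * t)"
    using z \<alpha> by (intro bexI[of _ z] exI[of _ "\<alpha> / 3"]) auto
qed

lemma norm_not_rough_imp_wstar_BDP:
  assumes Z: "subspace Z" and "norm_not_rough Z"
  shows "wstar_BDP Z"
  unfolding wstar_BDP_def
proof (intro allI impI)
  fix \<epsilon> :: real assume \<epsilon>: "\<epsilon> > 0"
  then have "\<epsilon> / 3 > 0" by simp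
  then obtain z t where z: "z \<in> Z" "norm z = 1" and t: "t > 0"
    and rough: "\<And>h. h \<in> Z \<Longrightarrow> norm h \<le> t \<Longrightarrow> norm (z + h) + norm (z - h) \<le> 2 + \<epsilon> / 3 * t"
    using assms(2) unfolding norm_not_rough_def by blast
  \<comment> \<open>For \<open>f, g\<close> in the slice, \<open>t (f - g) w\<close> is at most \<open>\<epsilon> t / 3\<close> from the norm estimate plus \<open>2 \<alpha>\<close> from
    \<open>f z + g z > 2 - 2 \<alpha>\<close>; with this \<open>\<alpha>\<close> the total is \<open>2 \<epsilon> t / 3\<close>.\<close>
  define \<alpha> where "\<alpha> = min (1 / 2) (\<epsilon> * t / 6)"
  have \<alpha>: "0 < \<alpha>" "\<alpha> < 1" "2 * \<alpha> \<le> \<epsilon> / 3 * t" using \<epsilon> t by (auto simp: \<alpha>_def)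
  have half: "f w - g w \<le> 2 * \<epsilon> / 3"
    if fg: "f \<in> wstar_slice Z z \<alpha>" "g \<in> wstar_slice Z z \<alpha>" and w: "w \<in> Z" "norm w \<le> 1" for f g w
  proof -
    have tw: "t *\<^sub>R w \<in> Z" "- t *\<^sub>R w \<in> Z"
      using Z w(1) by (rule subspace_scale)+
    have tw_norm: "norm (t *\<^sub>R w) \<le> t"
      using w(2) t by (simp add: mult_left_le)
    have mem: "z + t *\<^sub>R w \<in> Z" "z + - t *\<^sub>R w \<in> Z" 
      using subspace_add[OF Z z(1) tw(1)] subspace_add[OF Z z(1) tw(2)] .
    have dual: "f \<in> dual_space Z" "g \<in> dual_space Z" and ball: "f \<in> dual_ball Z" "g \<in> dual_ball Z"
      using fg by (auto simp: wstar_slice_def dual_ball_def)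
    have "f (z + t *\<^sub>R w) = f z + t * f w" "g (z + - t *\<^sub>R w) = g z + - t * g w"
      using dual_spaceD[OF dual(1)] dual_spaceD[OF dual(2)] z(1) tw w(1) by metis+
    moreover have "f (z + t *\<^sub>R w) \<le> norm (z + t *\<^sub>R w)" "g (z + - t *\<^sub>R w) \<le> norm (z - t *\<^sub>R w)"
      using dual_ballD[OF Z ball(1) mem(1)] dual_ballD[OF Z ball(2) mem(2)] by auto
    moreover have "f z > 1 - \<alpha>" "g z > 1 - \<alpha>"
      using fg by (auto simp: wstar_slice_def)
    ultimately have "t * f w - t * g w \<le> 2 * \<epsilon> / 3 * t"
      using rough[OF tw(1) tw_norm] \<alpha>(3) by auto
    then have "t * (f w - g w) \<le> t * (2 * \<epsilon> / 3)" by (simp add: algebra_simps)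
    with t show ?thesis by simp
  qed
  have small: "dual_norm Z (\<lambda>x. f x - g x) \<le> 2 * \<epsilon> / 3"
    if "f \<in> wstar_slice Z z \<alpha>" "g \<in> wstar_slice Z z \<alpha>" for f g
  proof (rule dual_norm_least)
    show "0 \<in> Z" using Z by (rule subspace_0)
  next
    fix w assume "w \<in> Z" "norm w \<le> 1"
    then show "\<bar>f w - g w\<bar> \<le> 2 * \<epsilon> / 3"
      using half[OF that, of w] half[OF that(2,1), of w] by linarith
  qed
  have "dual_diameter Z (wstar_slice Z z \<alpha>) \<le> 2 * \<epsilon> / 3"
  proof (cases "wstar_slice Z z \<alpha> = {}")
    case False
    then show ?thesis
      unfolding dual_diameter_def if_not_P[OF False]
      by (intro cSUP_least) (use small in \<open>auto simp del: le_divide_eq_numeral1\<close>)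
  qed (use \<epsilon> in \<open>simp add: dual_diameter_def\<close>)
  also have "\<dots> < \<epsilon>" using \<epsilon> by simp
  finally show "\<exists>z\<in>Z. \<exists>\<alpha>. norm z = 1 \<and> 0 < \<alpha> \<and> \<alpha> < 1 \<and> dual_diameter Z (wstar_slice Z z \<alpha>) < \<epsilon>"
    using z \<alpha> by blast
qed

lemma wstar_BDP_UNIV_small_slice:
  assumes "wstar_BDP (UNIV :: 'a::real_normed_vector set)" and "\<epsilon> > 0"
  obtains z :: "'a::real_normed_vector" and \<alpha> :: real where "norm z = 1" and "0 < \<alpha>" and "\<alpha> < 1"
    and "\<And>f g. norm f \<le> 1 \<Longrightarrow> norm g \<le> 1 \<Longrightarrow> blinfun_apply f z > 1 - \<alpha> \<Longrightarrow>
           blinfun_apply g z > 1 - \<alpha> \<Longrightarrow> norm (f - g) \<le> \<epsilon>"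
proof -
  define S where "S z \<alpha> = {f. f \<in> cball 0 1 \<and> blinfun_apply f z > 1 - \<alpha>}" for z :: 'a and \<alpha> :: real
  have "\<exists>z \<alpha>. norm z = 1 \<and> 0 < \<alpha> \<and> \<alpha> < 1 \<and> diameter (S z \<alpha>) < \<epsilon>"
    unfolding S_def using assms(2) by (rule assms(1)[unfolded wstar_BDP_UNIV, rule_format])
  then obtain z \<alpha> where z: "norm z = 1" "0 < \<alpha>" "\<alpha> < 1" and diam: "diameter (S z \<alpha>) < \<epsilon>"
    by blast
  have bdd: "bounded (S z \<alpha>)"
    by (rule bounded_subset[OF bounded_cball[of 0 1]]) (auto simp: S_def)
  have "norm (f - g) \<le> \<epsilon>"
    if "norm f \<le> 1" "norm g \<le> 1" "blinfun_apply f z > 1 - \<alpha>" "blinfun_apply g z > 1 - \<alpha>" for f g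
  proof -
    have "f \<in> S z \<alpha>" "g \<in> S z \<alpha>" using that by (auto simp: S_def)
    then have "dist f g \<le> diameter (S z \<alpha>)"
      by (rule diameter_bounded_bound[OF bdd])
    with diam show ?thesis by (simp add: dist_norm)
  qed
  then show thesis by (rule that[OF z])
qed

section \<open>Rank-one operators\<close>

lemma norm_rank_one: "norm (rank_one f y) = norm f * norm y"
proof (rule antisym)
  show "norm (rank_one f y) \<le> norm f * norm y"
  proof (rule norm_blinfun_bound)
    fix x
    show "norm (rank_one f y x) \<le> norm f * norm y * norm x"
      using mult_right_mono[OF norm_blinfun[of f x] norm_ge_zero[of y]]
      by (simp add: rank_one_apply mult_ac)
  qed simp
  show "norm f * norm y \<le> norm (rank_one f y)"
  proof (cases "y = 0")
    case False
    have "norm f \<le> norm (rank_one f y) / norm y"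
    proof (rule norm_blinfun_bound)
      fix x
      show "norm (f x) \<le> norm (rank_one f y) / norm y * norm x"
        using norm_blinfun[of "rank_one f y" x] False by (simp add: rank_one_apply field_simps)
    qed simp
    with False show ?thesis by (simp add: field_simps)
  qed simp
qed

lemma rank_one_mem_finite_rank_tensors: "rank_one f y \<in> finite_rank_tensors"
  unfolding finite_rank_tensors_def by (rule span_base) auto

lemma norm_blinfun_apply_le:
  assumes "norm x \<le> 1"
  shows "norm (blinfun_apply A x) \<le> norm A"
  using norm_blinfun[of A x] mult_left_mono[OF assms norm_ge_zero[of A]] by simp

lemma exists_near_norming_point:
  fixes A :: "'a::real_normed_vector \<Rightarrow>\<^sub>L 'b::real_normed_vector"
  assumes r: "0 \<le> r" "r < norm A"
  obtains x where "norm x = 1" and "r < norm (A x)"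
proof (rule ccontr)
  assume "\<not> thesis"
  with that have small: "norm (A x) \<le> r" if "norm x = 1" for x
    using \<open>norm x = 1\<close> by force
  have "norm A \<le> r"
  proof (rule norm_blinfun_bound[OF r(1)])
    fix x
    show "norm (A x) \<le> r * norm x"
    proof (cases "x = 0")
      case False
      then show ?thesis
        using small[of "x /\<^sub>R norm x"] by (simp add: blinfun.scaleR_right field_simps)
    qed simp
  qed
  with r show False by simp
qed

section \<open>From the operator space to the factors\<close>

text \<open>
  Images of a unit vector under contractions have norm only close to \<open>1\<close>. Normalising such a \<open>u\<close> moves
  it by less than \<open>\<delta>\<close>, which is absorbed by the term \<open>\<epsilon> * t\<close> because the scale \<open>t\<close> is chosen before
  \<open>\<delta>\<close>; this fixes the order of the quantifiers in the hypothesis.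
\<close>

lemma norm_not_rough_UNIV_I:
  assumes "\<And>\<epsilon>. \<epsilon> > 0 \<Longrightarrow> \<exists>t>0. \<forall>\<delta>>0. \<exists>u::'a::real_normed_vector.
    norm u > 1 - \<delta> \<and> norm u \<le> 1 \<and> (\<forall>h. norm h \<le> t \<longrightarrow> norm (u + h) + norm (u - h) \<le> 2 + \<epsilon> * t)"
  shows "norm_not_rough (UNIV :: 'a::real_normed_vector set)"
  unfolding norm_not_rough_def
proof (intro allI impI)
  fix \<epsilon> :: real assume "\<epsilon> > 0"
  then obtain t where t: "t > 0" and u_ex: "\<forall>\<delta>>0. \<exists>u::'a.
    norm u > 1 - \<delta> \<and> norm u \<le> 1 \<and> (\<forall>h. norm h \<le> t \<longrightarrow> norm (u + h) + norm (u - h) \<le> 2 + \<epsilon> / 2 * t)"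
    using assms[of "\<epsilon> / 2"] by auto
  define \<delta> where "\<delta> = min 1 (\<epsilon> * t / 4)"
  have \<delta>: "\<delta> > 0" "\<delta> \<le> 1" "2 * \<delta> \<le> \<epsilon> / 2 * t"
    using t \<open>\<epsilon> > 0\<close> by (auto simp: \<delta>_def)
  then obtain u :: 'a where u: "norm u > 1 - \<delta>" "norm u \<le> 1"
    and rough: "\<And>h. norm h \<le> t \<Longrightarrow> norm (u + h) + norm (u - h) \<le> 2 + \<epsilon> / 2 * t"
    using u_ex by blast
  define z where "z = u /\<^sub>R norm u"
  have "norm u > 0" using u \<delta> by linarith
  then have z: "norm z = 1" by (simp add: z_def)
  have "z - u = (1 - norm u) *\<^sub>R z"
    using \<open>norm u > 0\<close> by (simp add: z_def algebra_simps)
  then have "norm (z - u) = 1 - norm u"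
    using z u by simp
  then have zu: "norm (z - u) \<le> \<delta>" using u by simp
  have "norm (z + h) + norm (z - h) \<le> 2 + \<epsilon> * t" if "norm h \<le> t" for h
    using rough[OF that] zu \<delta>(3) norm_triangle_ineq[of "z - u" "u + h"]
      norm_triangle_ineq[of "z - u" "u - h"] by simp
  with z t show "\<exists>z\<in>UNIV. \<exists>t>0. norm (z::'a) = 1 \<and>
        (\<forall>h\<in>UNIV. norm h \<le> t \<longrightarrow> norm (z + h) + norm (z - h) \<le> 2 + \<epsilon> * t)"
    by blast
qed

text \<open>
  Evaluation at \<open>x\<close> is a contraction that sends \<open>rank_one f h\<close> to \<open>h\<close> when \<open>f x = 1\<close>, so perturbing
  \<open>S x\<close> by \<open>h\<close> costs no more than perturbing \<open>S\<close> by that operator.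
\<close>

lemma norm_not_rough_range:
  fixes H :: "('a::real_normed_vector \<Rightarrow>\<^sub>L 'b::real_normed_vector) set"
  assumes "finite_rank_tensors \<subseteq> H" and "norm_not_rough H"
  shows "norm_not_rough (UNIV :: 'b set)"
proof (rule norm_not_rough_UNIV_I)
  fix \<epsilon> :: real assume "\<epsilon> > 0"
  then obtain S t where S: "norm S = 1" and t: "t > 0"
    and rough: "\<And>T. T \<in> H \<Longrightarrow> norm T \<le> t \<Longrightarrow> norm (S + T) + norm (S - T) \<le> 2 + \<epsilon> * t"
    using assms(2) unfolding norm_not_rough_def by blast
  have "\<exists>u::'b. norm u > 1 - \<delta> \<and> norm u \<le> 1 \<and>
      (\<forall>h. norm h \<le> t \<longrightarrow> norm (u + h) + norm (u - h) \<le> 2 + \<epsilon> * t)" if "\<delta> > 0" for \<delta>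
  proof -
    obtain x where x: "norm x = 1" "max 0 (1 - \<delta>) < norm (S x)"
      using exists_near_norming_point[of "max 0 (1 - \<delta>)" S] S \<open>\<delta> > 0\<close> by auto
    obtain f :: "'a \<Rightarrow>\<^sub>L real" where f: "norm f \<le> 1" "f x = norm x"
      by (rule norming_functional)
    have "norm (S x + h) + norm (S x - h) \<le> 2 + \<epsilon> * t" if h: "norm h \<le> t" for h
    proof -
      let ?T = "rank_one f h"
      have "norm ?T \<le> t"
        using mult_right_mono[OF f(1) norm_ge_zero[of h]] h by (simp add: norm_rank_one)
      then have "norm (S + ?T) + norm (S - ?T) \<le> 2 + \<epsilon> * t"
        using assms(1) rank_one_mem_finite_rank_tensors by (intro rough) auto
      moreover have "norm ((S + ?T) x) \<le> norm (S + ?T)" "norm ((S - ?T) x) \<le> norm (S - ?T)"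
        using x(1) by (auto intro: norm_blinfun_apply_le)
      ultimately show ?thesis
        using x(1) f(2) by (simp add: blinfun.add_left blinfun.diff_left rank_one_apply)
    qed
    moreover have "norm (S x) \<le> 1"
      using norm_blinfun_apply_le[of x S] S x(1) by simp
    ultimately show ?thesis using x(2) by auto
  qed
  with t show "\<exists>t>0. \<forall>\<delta>>0. \<exists>u::'b. norm u > 1 - \<delta> \<and> norm u \<le> 1 \<and>
      (\<forall>h. norm h \<le> t \<longrightarrow> norm (u + h) + norm (u - h) \<le> 2 + \<epsilon> * t)"
    by blast
qed

text \<open>
  Dual to the previous argument: composition with \<open>g\<close> is a contraction that sends \<open>rank_one h y\<close> to
  \<open>h\<close> when \<open>g y = 1\<close>.
\<close>

lemma norm_not_rough_dual_domain:
  fixes H :: "('a::real_normed_vector \<Rightarrow>\<^sub>L 'b::real_normed_vector) set"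
  assumes "finite_rank_tensors \<subseteq> H" and "norm_not_rough H"
  shows "norm_not_rough (UNIV :: ('a \<Rightarrow>\<^sub>L real) set)"
proof (rule norm_not_rough_UNIV_I)
  fix \<epsilon> :: real assume "\<epsilon> > 0"
  then obtain S t where S: "norm S = 1" and t: "t > 0"
    and rough: "\<And>T. T \<in> H \<Longrightarrow> norm T \<le> t \<Longrightarrow> norm (S + T) + norm (S - T) \<le> 2 + \<epsilon> * t"
    using assms(2) unfolding norm_not_rough_def by blast
  have "\<exists>u::'a \<Rightarrow>\<^sub>L real. norm u > 1 - \<delta> \<and> norm u \<le> 1 \<and>
      (\<forall>h. norm h \<le> t \<longrightarrow> norm (u + h) + norm (u - h) \<le> 2 + \<epsilon> * t)" if "\<delta> > 0" for \<delta>
  proof -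
    obtain x where x: "norm x = 1" "max 0 (1 - \<delta>) < norm (S x)"
      using exists_near_norming_point[of "max 0 (1 - \<delta>)" S] S \<open>\<delta> > 0\<close> by auto
    obtain g :: "'b \<Rightarrow>\<^sub>L real" where g: "norm g \<le> 1" "g (S x) = norm (S x)"
      by (rule norming_functional)
    define y where "y = S x /\<^sub>R norm (S x)"
    have y: "norm y = 1" "g y = 1"
      using x(2) g(2) by (auto simp: y_def blinfun.scaleR_right)
    have comp: "norm (g o\<^sub>L A) \<le> norm A" for A :: "'a \<Rightarrow>\<^sub>L 'b"
      using norm_blinfun_compose[of g A] mult_right_mono[OF g(1) norm_ge_zero[of A]] by simp
    have "norm ((g o\<^sub>L S) + h) + norm ((g o\<^sub>L S) - h) \<le> 2 + \<epsilon> * t" if h: "norm h \<le> t" for h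
    proof -
      let ?T = "rank_one h y"
      have "norm (S + ?T) + norm (S - ?T) \<le> 2 + \<epsilon> * t"
        using assms(1) rank_one_mem_finite_rank_tensors h y
        by (intro rough) (auto simp: norm_rank_one)
      moreover have "g o\<^sub>L (S + ?T) = (g o\<^sub>L S) + h" "g o\<^sub>L (S - ?T) = (g o\<^sub>L S) - h"
        using y by (auto intro!: blinfun_eqI simp: blinfun.bilinear_simps rank_one_apply)
      ultimately show ?thesis
        using comp[of "S + ?T"] comp[of "S - ?T"] by simp
    qed
    moreover have "norm (g o\<^sub>L S) \<le> 1" using comp[of S] S by simp
    moreover have "norm (S x) \<le> norm (g o\<^sub>L S)"
      using norm_blinfun_apply_le[of x "g o\<^sub>L S"] x(1) g(2) by simp
    ultimately show ?thesis using x(2) by (intro exI[of _ "g o\<^sub>L S"]) auto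
  qed
  with t show "\<exists>t>0. \<forall>\<delta>>0. \<exists>u::'a \<Rightarrow>\<^sub>L real. norm u > 1 - \<delta> \<and> norm u \<le> 1 \<and>
      (\<forall>h. norm h \<le> t \<longrightarrow> norm (u + h) + norm (u - h) \<le> 2 + \<epsilon> * t)"
    by blast
qed

section \<open>From the factors to the operator space\<close>

text \<open>
  The canonical embedding into the bidual is isometric, and a vector \<open>x\<close> of the unit ball with
  \<open>f x > 1 - \<alpha>\<close> is mapped into the slice determined by \<open>f\<close>. This is how the slices of the bidual
  control vectors of the space itself.
\<close>

lemma bidual_slice_points_close:
  fixes f :: "'a::real_normed_vector \<Rightarrow>\<^sub>L real"
  assumes slice: "\<And>\<phi> \<psi>. norm \<phi> \<le> 1 \<Longrightarrow> norm \<psi> \<le> 1 \<Longrightarrow>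
      blinfun_apply \<phi> f > 1 - \<alpha> \<Longrightarrow> blinfun_apply \<psi> f > 1 - \<alpha> \<Longrightarrow> norm (\<phi> - \<psi>) \<le> \<epsilon>"
    and x: "norm x \<le> 1" "norm x' \<le> 1" "f x > 1 - \<alpha>" "f x' > 1 - \<alpha>"
  shows "norm (x - x') \<le> \<epsilon>"
proof -
  define ev :: "'a \<Rightarrow> ('a \<Rightarrow>\<^sub>L real) \<Rightarrow>\<^sub>L real" where "ev v = Blinfun (\<lambda>g. blinfun_apply g v)" for v
  have ev: "ev v g = blinfun_apply g v" for v g
    by (simp add: ev_def bounded_linear_Blinfun_apply blinfun.bounded_linear_left)
  have norm_ev: "norm (ev v) \<le> norm v" for v
  proof (rule norm_blinfun_bound)
    show "norm (ev v g) \<le> norm v * norm g" for g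
      using norm_blinfun[of g v] by (simp add: ev mult.commute)
  qed simp
  have close: "norm (ev x - ev x') \<le> \<epsilon>"
    using x norm_ev[of x] norm_ev[of x'] by (intro slice) (auto simp: ev)
  obtain g :: "'a \<Rightarrow>\<^sub>L real" where g: "norm g \<le> 1" "g (x - x') = norm (x - x')"
    by (rule norming_functional)
  have "norm (x - x') = (ev x - ev x') g"
    using g(2) by (simp add: blinfun.diff_left blinfun.diff_right ev)
  also have "\<dots> \<le> norm (ev x - ev x')"
    using norm_blinfun_apply_le[OF g(1), of "ev x - ev x'"] by simp
  finally show ?thesis using close by simp
qed

text \<open>
  A pair \<open>(x, g)\<close> with \<open>g (A x)\<close> near \<open>\<parallel>A\<parallel>\<close> satisfies \<open>f x * g y \<ge> \<parallel>A\<parallel> - \<eta> - t \<ge> 1 - 2 t - \<eta>\<close>, as \<open>A\<close>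
  is within \<open>t\<close> of \<open>rank_one f y\<close>. Both factors have modulus at most \<open>1\<close>, so both exceed \<open>1 - \<alpha>\<close> in
  modulus; they have the same sign, and replacing \<open>(x, g)\<close> by \<open>(- x, - g)\<close> leaves \<open>g (A x)\<close> unchanged.
\<close>

lemma near_rank_one_norming_pair:
  fixes A :: "'a::real_normed_vector \<Rightarrow>\<^sub>L 'b::real_normed_vector"
  assumes f: "norm f = 1" and y: "norm y = 1" and A: "norm (A - rank_one f y) \<le> t"
    and "\<eta> > 0" and small: "2 * t + \<eta> \<le> \<alpha>" "\<alpha> < 1"
  obtains x and g :: "'b \<Rightarrow>\<^sub>L real"
  where "norm x \<le> 1" and "norm g \<le> 1" and "f x > 1 - \<alpha>" and "g y > 1 - \<alpha>"
    and "norm A - \<eta> < g (A x)"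
proof -
  let ?z = "rank_one f y"
  have "norm ?z = 1" using f y by (simp add: norm_rank_one)
  then have normA: "norm A \<ge> 1 - t"
    using norm_triangle_ineq2[of ?z "?z - A"] A by (simp add: norm_minus_commute)
  have "t \<ge> 0" using A norm_ge_zero order_trans by blast
  then have "0 \<le> norm A - \<eta>" "norm A - \<eta> < norm A"
    using normA small \<open>\<eta> > 0\<close> by auto
  then obtain x where x: "norm x = 1" "norm A - \<eta> < norm (A x)"
    by (rule exists_near_norming_point)
  obtain g :: "'b \<Rightarrow>\<^sub>L real" where g: "norm g \<le> 1" "g (A x) = norm (A x)"
    by (rule norming_functional)
  have g_le: "\<bar>g v\<bar> \<le> norm v" for v
    using norm_blinfun[of g v] mult_right_mono[OF g(1) norm_ge_zero[of v]] by simp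
  have "g ((A - ?z) x) \<le> t"
    using g_le[of "(A - ?z) x"] norm_blinfun_apply_le[of x "A - ?z"] x(1) A by simp
  then have prod: "f x * g y > 1 - \<alpha>"
    using g(2) x(2) normA small
    by (simp add: blinfun.diff_left blinfun.diff_right rank_one_apply blinfun.scaleR_right)
  have bounds: "\<bar>f x\<bar> \<le> 1" "\<bar>g y\<bar> \<le> 1"
    using norm_blinfun_apply_le[of x f] g_le[of y] x(1) f y by auto
  have "\<bar>f x\<bar> * \<bar>g y\<bar> > 1 - \<alpha>" using prod by (simp flip: abs_mult)
  then have large: "\<bar>f x\<bar> > 1 - \<alpha>" "\<bar>g y\<bar> > 1 - \<alpha>"
    using bounds mult_left_le[of "\<bar>g y\<bar>" "\<bar>f x\<bar>"] mult_left_le[of "\<bar>f x\<bar>" "\<bar>g y\<bar>"]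
    by (auto simp: mult.commute)
  have "f x * g y > 0" using prod small by simp
  then consider "f x > 0" "g y > 0" | "f x < 0" "g y < 0"
    by (auto simp: zero_less_mult_iff)
  then show thesis
  proof cases
    case 1
    then show ?thesis using that[of x g] x g large by simp
  next
    case 2
    then show ?thesis
      using that[of "- x" "- g"] x g large by (simp add: blinfun.minus_left blinfun.minus_right)
  qed
qed

lemma norm_not_rough_operators:
  fixes H :: "('a::real_normed_vector \<Rightarrow>\<^sub>L 'b::real_normed_vector) set"
  assumes H: "finite_rank_tensors \<subseteq> H"
    and X: "wstar_BDP (UNIV :: ('a \<Rightarrow>\<^sub>L real) set)" and Y: "wstar_BDP (UNIV :: 'b set)"
  shows "norm_not_rough H"
  unfolding norm_not_rough_def
proof (intro allI impI)
  fix \<epsilon> :: real assume "\<epsilon> > 0"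
  then have \<epsilon>: "\<epsilon> / 2 > 0" by simp
  obtain f :: "'a \<Rightarrow>\<^sub>L real" and \<alpha>\<^sub>1 :: real where f: "norm f = 1" and \<alpha>\<^sub>1: "0 < \<alpha>\<^sub>1" "\<alpha>\<^sub>1 < 1"
    and slice_f: "\<And>\<phi> \<psi>. norm \<phi> \<le> 1 \<Longrightarrow> norm \<psi> \<le> 1 \<Longrightarrow>
      blinfun_apply \<phi> f > 1 - \<alpha>\<^sub>1 \<Longrightarrow> blinfun_apply \<psi> f > 1 - \<alpha>\<^sub>1 \<Longrightarrow> norm (\<phi> - \<psi>) \<le> \<epsilon> / 2"
    by (rule wstar_BDP_UNIV_small_slice[OF X \<epsilon>]) blast
  obtain y :: 'b and \<alpha>\<^sub>2 :: real where y: "norm y = 1" and \<alpha>\<^sub>2: "0 < \<alpha>\<^sub>2" "\<alpha>\<^sub>2 < 1"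
    and slice_y: "\<And>g g'. norm g \<le> 1 \<Longrightarrow> norm g' \<le> 1 \<Longrightarrow>
      blinfun_apply g y > 1 - \<alpha>\<^sub>2 \<Longrightarrow> blinfun_apply g' y > 1 - \<alpha>\<^sub>2 \<Longrightarrow> norm (g - g') \<le> \<epsilon> / 2"
    by (rule wstar_BDP_UNIV_small_slice[OF Y \<epsilon>]) blast
  define \<alpha> where "\<alpha> = min \<alpha>\<^sub>1 \<alpha>\<^sub>2"
  have \<alpha>: "0 < \<alpha>" "\<alpha> < 1" "\<alpha> \<le> \<alpha>\<^sub>1" "\<alpha> \<le> \<alpha>\<^sub>2" using \<alpha>\<^sub>1 \<alpha>\<^sub>2 by (auto simp: \<alpha>_def)
  \<comment> \<open>Together with \<open>\<eta> \<le> t\<close> below this gives \<open>2 t + \<eta> \<le> \<alpha>\<close>, as required for the near-norming pairs.\<close>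
  define t where "t = \<alpha> / 3"
  have t: "t > 0" using \<alpha> by (simp add: t_def)
  let ?z = "rank_one f y"
  have "norm (?z + h) + norm (?z - h) \<le> 2 + \<epsilon> * t" if h: "norm h \<le> t" for h
    \<comment> \<open>The operator norms need not be attained, hence the slack \<open>e\<close>.\<close>
  proof (rule field_le_epsilon)
    fix e :: real assume "e > 0"
    define \<eta> where "\<eta> = min (e / 2) t"
    have \<eta>: "\<eta> > 0" "2 * \<eta> \<le> e" "2 * t + \<eta> \<le> \<alpha>"
      using \<open>e > 0\<close> t by (auto simp: \<eta>_def t_def)
    obtain x g where x: "norm x \<le> 1" "f x > 1 - \<alpha>" and g: "norm g \<le> 1" "blinfun_apply g y > 1 - \<alpha>"
      and plus: "norm (?z + h) - \<eta> < blinfun_apply g ((?z + h) x)"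
      by (rule near_rank_one_norming_pair[OF f y _ \<eta>(1,3) \<alpha>(2), of "?z + h"]) (use h in auto)
    obtain x' g' where x': "norm x' \<le> 1" "f x' > 1 - \<alpha>" and g': "norm g' \<le> 1" "blinfun_apply g' y > 1 - \<alpha>"
      and minus: "norm (?z - h) - \<eta> < blinfun_apply g' ((?z - h) x')"
      by (rule near_rank_one_norming_pair[OF f y _ \<eta>(1,3) \<alpha>(2), of "?z - h"]) (use h in auto)
    have close_x: "norm (x - x') \<le> \<epsilon> / 2"
      by (rule bidual_slice_points_close[OF slice_f]) (use x x' \<alpha> in auto)
    have close_g: "norm (g - g') \<le> \<epsilon> / 2"
      by (rule slice_y) (use g g' \<alpha> in auto)
    have le_1: "blinfun_apply k (?z v) \<le> 1" if "norm v \<le> 1" "norm k \<le> 1" for v and k :: "'b \<Rightarrow>\<^sub>L real"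
    proof -
      have "norm (k (?z v)) \<le> norm k * norm (?z v)" by (rule norm_blinfun)
      also have "\<dots> \<le> 1 * 1"
        using that norm_blinfun_apply_le[of v ?z] f y
        by (intro mult_mono) (auto simp: norm_rank_one)
      finally show ?thesis by simp
    qed
    have "norm (g (h (x - x'))) \<le> norm g * norm (h (x - x'))" by (rule norm_blinfun)
    also have "\<dots> \<le> 1 * (norm h * norm (x - x'))"
      using g(1) norm_blinfun by (intro mult_mono) auto
    also have "\<dots> \<le> 1 * (t * (\<epsilon> / 2))"
      using h close_x t by (intro mult_mono) auto
    finally have 1: "g (h (x - x')) \<le> t * (\<epsilon> / 2)" by simp
    have "norm ((g - g') (h x')) \<le> norm (g - g') * norm (h x')" by (rule norm_blinfun)
    also have "\<dots> \<le> \<epsilon> / 2 * t"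
      using close_g norm_blinfun_apply_le[OF x'(1), of h] h \<epsilon> by (intro mult_mono) auto
    finally have 2: "(g - g') (h x') \<le> \<epsilon> / 2 * t" by simp
    have "g ((?z + h) x) + g' ((?z - h) x') =
        g (?z x) + g' (?z x') + g (h (x - x')) + (g - g') (h x')"
      by (simp add: blinfun.bilinear_simps)
    also have "\<dots> \<le> 2 + \<epsilon> * t"
      using le_1[OF x(1) g(1)] le_1[OF x'(1) g'(1)] 1 2 by (simp add: algebra_simps)
    finally show "norm (?z + h) + norm (?z - h) \<le> 2 + \<epsilon> * t + e"
      using plus minus \<eta>(2) by linarith
  qed
  moreover have "?z \<in> H" using H rank_one_mem_finite_rank_tensors by blast
  moreover have "norm ?z = 1" using f y by (simp add: norm_rank_one)
  ultimately show "\<exists>z\<in>H. \<exists>t>0. norm z = 1 \<and>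
        (\<forall>h\<in>H. norm h \<le> t \<longrightarrow> norm (z + h) + norm (z - h) \<le> 2 + \<epsilon> * t)"
    using t by blast
qed

theorem theorem2p6:
  fixes H :: "('a::banach \<Rightarrow>\<^sub>L 'b::banach) set"
  assumes "subspace H" and "closed H" and "finite_rank_tensors \<subseteq> H"
  shows "wstar_BDP H \<longleftrightarrow>
    wstar_BDP (UNIV :: ('a \<Rightarrow>\<^sub>L real) set) \<and> wstar_BDP (UNIV :: 'b set)"
proof
  assume "wstar_BDP H"
  with assms(1) have "norm_not_rough H" by (rule wstar_BDP_imp_norm_not_rough)
  with assms(3) show "wstar_BDP (UNIV :: ('a \<Rightarrow>\<^sub>L real) set) \<and> wstar_BDP (UNIV :: 'b set)"
    by (simp add: norm_not_rough_imp_wstar_BDP norm_not_rough_dual_domain norm_not_rough_range)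
next
  assume "wstar_BDP (UNIV :: ('a \<Rightarrow>\<^sub>L real) set) \<and> wstar_BDP (UNIV :: 'b set)"
  with assms(3) have "norm_not_rough H" by (simp add: norm_not_rough_operators)
  with assms(1) show "wstar_BDP H" by (rule norm_not_rough_imp_wstar_BDP)
qed

end
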